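(* Let $c>1$ and let $\Phi$ be an implicit set system. If $\Phi$ is $c$-uniform, then $|\mathcal{F}_I|\le \left(2-\frac{1}{c}\right)^n n^{\mathcal{O}(1)}$ for every instance $I$, where $n=|U_I|$.
   Context: An implicit set system is a function $\Phi$ that takes as input a string $I\in\{0,1\}^*$ (an instance) and outputs a set system $(U_I,\mathcal{F}_I)$, where $U_I$ is a finite universe and $\mathcal{F}_I$ is a collection of subsets of $U_I$; $n=|U_I|$. For an instance $I$, a set $X\subseteq U_I$ and an integer $k$, let $\mathcal{F}_{I,X}^k=\{S\subseteq U_I\setminus X : |S|=k \text{ and } S\cup X\in\mathcal{F}_I\}$. $\Phi$ is $c$-uniform if for every instance $I$, every $X\subseteq U_I$ and every integer $k\le n-|X|$, we have $|\mathcal{F}_{I,X}^k|\le c^k n^{\mathcal{O}(1)}$ (with the polynomial independent of $I,X,k$). *)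

theory Defs
  imports Complex_Main "HOL-Computational_Algebra.Polynomial"
begin

type_synonym 'a set_system = "'a set \<times> 'a set set"

definition is_set_system :: "'a set_system \<Rightarrow> bool" where
  "is_set_system S \<longleftrightarrow> finite (fst S) \<and> snd S \<subseteq> Pow (fst S)"

text \<open>Instances are binary strings, represented as lists of booleans.\<close>

definition implicit_set_system :: "(bool list \<Rightarrow> 'a set_system) \<Rightarrow> bool" where
  "implicit_set_system \<Phi> \<longleftrightarrow> (\<forall>I. is_set_system (\<Phi> I))"

abbreviation universe :: "(bool list \<Rightarrow> 'a set_system) \<Rightarrow> bool list \<Rightarrow> 'a set" where
  "universe \<Phi> I \<equiv> fst (\<Phi> I)"

abbreviation family :: "(bool list \<Rightarrow> 'a set_system) \<Rightarrow> bool list \<Rightarrow> 'a set set" where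
  "family \<Phi> I \<equiv> snd (\<Phi> I)"

definition extensions ::
    "(bool list \<Rightarrow> 'a set_system) \<Rightarrow> bool list \<Rightarrow> 'a set \<Rightarrow> nat \<Rightarrow> 'a set set" where
  "extensions \<Phi> I X k =
     {S. S \<subseteq> universe \<Phi> I - X \<and> card S = k \<and> S \<union> X \<in> family \<Phi> I}"

text \<open>
  A factor \<open>n\<^bsup>O(1)\<^esup>\<close> is a real polynomial in \<open>n\<close>, chosen before the instance. It is not a
  bare power \<open>n ^ d\<close>, which would allow no constant factor when \<open>n \<le> 1\<close>.
  A negative \<open>k\<close> would give an empty collection of extensions, so \<open>k\<close> is a natural number.
\<close>

definition c_uniform :: "real \<Rightarrow> (bool list \<Rightarrow> 'a set_system) \<Rightarrow> bool" where
  "c_uniform c \<Phi> \<longleftrightarrow>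
     (\<exists>p :: real poly. \<forall>I X k.
        X \<subseteq> universe \<Phi> I \<longrightarrow> k \<le> card (universe \<Phi> I) - card X \<longrightarrow>
        real (card (extensions \<Phi> I X k)) \<le> c ^ k * poly p (real (card (universe \<Phi> I))))"

end

theory Submission
  imports Defs
begin

text \<open>
  Double counting of the pairs \<open>X \<subseteq> S \<in> F\<close>: weigh a set \<open>X\<close> of size \<open>j\<close> with \<open>(1 - 1/c)\<^sup>j\<close> and an
  extension of \<open>X\<close> by \<open>k\<close> elements with a further factor \<open>(1/c)\<^sup>k\<close>.
  These weights are chosen such that every \<open>S\<close> receives total weight
  \<open>\<Sum>X\<subseteq>S. (1 - 1/c)\<^bsup>|X|\<^esup> (1/c)\<^bsup>|S - X|\<^esup> = 1\<close>. For a fixed \<open>X\<close>, uniformity bounds the weight of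
  its extensions by a polynomial, and the total weight of all \<open>X\<close> is \<open>(2 - 1/c)\<^sup>n\<close>.
\<close>

text \<open>Expand the product of \<open>a + b\<close> over the elements of \<open>A\<close>: the
  subset \<open>X\<close> records which factors contribute \<open>a\<close>.\<close>

lemma sum_Pow_power_card:
  fixes a b :: "'b :: comm_semiring_1"
  assumes "finite A"
  shows "(\<Sum>X\<in>Pow A. a ^ card X * b ^ card (A - X)) = (a + b) ^ card A"
  using prod_add[OF assms, of "\<lambda>_. a" "\<lambda>_. b"] by simp

lemma card_eq_sum_over_subsets:
  fixes a b :: real
  assumes U: "finite U" "F \<subseteq> Pow U" and ab: "a + b = 1"
  shows "real (card F) =
    (\<Sum>X\<in>Pow U. a ^ card X * (\<Sum>S | S \<in> F \<and> X \<subseteq> S. b ^ card (S - X)))"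
proof -
  have F: "finite F"
    using U finite_subset by blast
  have "real (card F) = (\<Sum>S\<in>F. \<Sum>X\<in>Pow S. a ^ card X * b ^ card (S - X))"
  proof -
    have "(\<Sum>X\<in>Pow S. a ^ card X * b ^ card (S - X)) = 1" if "S \<in> F" for S
      using sum_Pow_power_card[of S a b] ab U that finite_subset[of S U] by auto
    then show ?thesis by simp
  qed
  also have "\<dots> = (\<Sum>S\<in>F. \<Sum>X | X \<in> Pow U \<and> X \<subseteq> S. a ^ card X * b ^ card (S - X))"
    using U by (intro sum.cong) auto
  also have "\<dots> = (\<Sum>X\<in>Pow U. \<Sum>S | S \<in> F \<and> X \<subseteq> S. a ^ card X * b ^ card (S - X))"
    using F U by (intro sum.swap_restrict) auto
  finally show ?thesis
    by (simp add: sum_distrib_left)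
qed

text \<open>Supersets \<open>S\<close> of \<open>X\<close> in \<open>F\<close> correspond to the
  sets \<open>T = S - X\<close> disjoint from \<open>X\<close>. Grouping these by size produces
  exactly the counts that uniformity bounds.\<close>

lemma sum_supersets_eq_sum_card:
  fixes b :: real
  assumes U: "finite U" "F \<subseteq> Pow U" and X: "X \<subseteq> U"
  shows "(\<Sum>S | S \<in> F \<and> X \<subseteq> S. b ^ card (S - X)) =
    (\<Sum>k\<le>card U - card X. real (card {T. T \<subseteq> U - X \<and> card T = k \<and> T \<union> X \<in> F}) * b ^ k)"
proof -
  define G where "G = {T. T \<subseteq> U - X \<and> T \<union> X \<in> F}"
  have G: "finite G"
    unfolding G_def using U by (auto intro: finite_subset[of _ "Pow U"])
  have card_le: "card T \<le> card U - card X" if "T \<in> G" for T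
    using that card_mono[of "U - X" T] U X
    by (simp add: G_def card_Diff_subset finite_subset[OF X])
  have "(\<Sum>S | S \<in> F \<and> X \<subseteq> S. b ^ card (S - X)) = (\<Sum>T\<in>G. b ^ card T)"
    using U
    by (intro sum.reindex_bij_witness[of _ "\<lambda>T. T \<union> X" "\<lambda>S. S - X"])
       (auto simp: G_def Un_absorb2 intro: arg_cong[where f = "\<lambda>A. b ^ card A"])
  also have "\<dots> = (\<Sum>k\<le>card U - card X. \<Sum>T | T \<in> G \<and> card T = k. b ^ card T)"
    using G card_le by (intro sum.group[symmetric]) auto
  also have "\<dots> = (\<Sum>k\<le>card U - card X. real (card {T. T \<in> G \<and> card T = k}) * b ^ k)"
    by simp
  finally show ?thesis
    by (simp add: G_def conj_ac)
qed

theorem theorem3: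
  fixes c :: real and \<Phi> :: "bool list \<Rightarrow> 'a set_system"
  assumes "c > 1"
    and "implicit_set_system \<Phi>"
    and "c_uniform c \<Phi>"
  shows "\<exists>p :: real poly. \<forall>I.
           real (card (family \<Phi> I)) \<le>
             (2 - 1 / c) ^ card (universe \<Phi> I) * poly p (real (card (universe \<Phi> I)))"
proof -
  obtain p :: "real poly" where p: "\<And>I X k. X \<subseteq> universe \<Phi> I \<Longrightarrow>
      k \<le> card (universe \<Phi> I) - card X \<Longrightarrow>
      real (card (extensions \<Phi> I X k)) \<le> c ^ k * poly p (real (card (universe \<Phi> I)))"
    using assms(3) unfolding c_uniform_def by blast
  \<comment> \<open>The factor \<open>[:1, 1:]\<close>, that is n + 1, bounds the number of possible
    extension sizes \<open>k\<close>.\<close>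
  have "real (card (family \<Phi> I)) \<le>
      (2 - 1 / c) ^ card (universe \<Phi> I) * poly ([:1, 1:] * p) (real (card (universe \<Phi> I)))" for I
  proof -
    define U F where "U = universe \<Phi> I" and "F = family \<Phi> I"
    define q where "q = poly p (real (card U))"
    have U: "finite U" "F \<subseteq> Pow U"
      using assms(2) by (auto simp: U_def F_def implicit_set_system_def is_set_system_def)
    \<comment> \<open>\<open>p\<close> may take negative values elsewhere, but here uniformity at
      \<open>k = 0\<close> bounds a cardinality by \<open>q\<close>.\<close>
    have "q \<ge> 0"
      using p[of "{}" I 0] by (simp add: q_def U_def)
    have weight: "(\<Sum>S | S \<in> F \<and> X \<subseteq> S. (1 / c) ^ card (S - X)) \<le> (1 + real (card U)) * q"
      if X: "X \<subseteq> U" for X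
    proof -
      have "(\<Sum>S | S \<in> F \<and> X \<subseteq> S. (1 / c) ^ card (S - X)) =
          (\<Sum>k\<le>card U - card X. real (card (extensions \<Phi> I X k)) * (1 / c) ^ k)"
        using sum_supersets_eq_sum_card[OF U X] by (simp add: extensions_def U_def F_def)
      also have "\<dots> \<le> (\<Sum>k\<le>card U - card X. q)"
      proof (rule sum_mono)
        fix k assume "k \<in> {..card U - card X}"
        then have "real (card (extensions \<Phi> I X k)) \<le> c ^ k * q"
          using p[of X I k] X by (simp add: q_def U_def)
        \<comment> \<open>The weight \<open>(1 / c) ^ k\<close> cancels the growth
          \<open>c ^ k\<close>, so every size contributes at most \<open>q\<close>.\<close>
        then show "real (card (extensions \<Phi> I X k)) * (1 / c) ^ k \<le> q"
          using \<open>c > 1\<close> by (simp add: field_simps)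
      qed
      also have "\<dots> \<le> (1 + real (card U)) * q"
        using \<open>q \<ge> 0\<close> by (auto intro!: mult_right_mono)
      finally show ?thesis .
    qed
    have "real (card F) = (\<Sum>X\<in>Pow U. (1 - 1 / c) ^ card X *
        (\<Sum>S | S \<in> F \<and> X \<subseteq> S. (1 / c) ^ card (S - X)))"
      by (rule card_eq_sum_over_subsets[OF U]) simp
    also have "\<dots> \<le> (\<Sum>X\<in>Pow U. (1 - 1 / c) ^ card X * ((1 + real (card U)) * q))"
      using weight \<open>c > 1\<close> by (intro sum_mono mult_left_mono) auto
    also have "\<dots> = (\<Sum>X\<in>Pow U. (1 - 1 / c) ^ card X) * ((1 + real (card U)) * q)"
      by (simp add: sum_distrib_right)
    \<comment> \<open>Elements outside \<open>X\<close> now carry weight 1, so the base is (1 - 1/c)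
      + 1.\<close>
    also have "(\<Sum>X\<in>Pow U. (1 - 1 / c) ^ card X) = (2 - 1 / c) ^ card U"
      using sum_Pow_power_card[OF U(1), of "1 - 1 / c" 1] by simp
    finally show ?thesis
      by (simp add: U_def F_def q_def distrib_right)
  qed
  then show ?thesis by blast
qed

end
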